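(* Fix $n\ge1$ and consider the Gaussian model of a complex 3-index tensor $\Phi^{i_1i_2i_3}$, $i_a\in\{1,\dots,N_a\}$, with $\langle\Phi^{i_1i_2i_3}\bar\Phi^{j_1j_2j_3}\rangle=\delta^{i_1j_1}\delta^{i_2j_2}\delta^{i_3j_3}$. In the limit $N_1,N_2,N_3\to\infty$, the (rescaled) normal-ordered two-point function is diagonal on equivalence classes of observables with positive diagonal values: for all $\sigma_a,\tau_a\in S_n$ ($a=1,2,3$), the limit $$\lim_{N_1,N_2,N_3\to\infty}\frac{\langle\mathcal O_{\sigma_1,\sigma_2,\sigma_3}\,\bar{\mathcal O}_{\tau_1,\tau_2,\tau_3}\rangle}{N_1^nN_2^nN_3^n}$$ exists, is strictly positive if there are $\gamma_1,\gamma_2\in S_n$ with $\tau_a=\gamma_1\sigma_a\gamma_2$ for $a=1,2,3$, and is zero otherwise.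
   Context: $S_n$ is the symmetric group on $\{1,\dots,n\}$. The observable is $$\mathcal O_{\sigma_1,\sigma_2,\sigma_3}=\sum_{i^a_m}\ \prod_{m=1}^n\Phi^{i^1_m i^2_m i^3_m}\ \prod_{m=1}^n\bar\Phi^{\,i^1_{\sigma_1(m)}i^2_{\sigma_2(m)}i^3_{\sigma_3(m)}},$$ the sum being over all $i^a_m\in\{1,\dots,N_a\}$, $a=1,2,3$, $m=1,\dots,n$; it depends only on the class of $(\sigma_1,\sigma_2,\sigma_3)$ under $(\sigma_1,\sigma_2,\sigma_3)\sim(\gamma_1\sigma_1\gamma_2,\gamma_1\sigma_2\gamma_2,\gamma_1\sigma_3\gamma_2)$, $\gamma_1,\gamma_2\in S_n$. $\bar{\mathcal O}_{\tau_1,\tau_2,\tau_3}=\mathcal O_{\tau_1^{-1},\tau_2^{-1},\tau_3^{-1}}$. The normal-ordered two-point function $\langle\mathcal O\,\mathcal O'\rangle$ is the sum over all Wick contractions (perfect matchings of $\Phi$'s with $\bar\Phi$'s, each matched pair replaced by the two-point function of $\Phi$ and $\bar\Phi$) in which no $\Phi$ is matched with a $\bar\Phi$ belonging to the same observable. *)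

theory Defs
  imports Complex_Main "HOL-Library.FuncSet" "HOL-Library.Multiset" "HOL-Combinatorics.Permutations"
begin

type_synonym label = "nat \<times> nat \<times> nat"

text \<open>
  A pair (u, v) stands for the monomial with factors \<open>\<Phi>\<close> at \<open>u 1, \<dots>, u n\<close> and
  \<open>\<Phi>\<close>-bar at \<open>v 1, \<dots>, v n\<close>. The individual factors have to be kept apart, because
  Wick contractions match factors. A homogeneous polynomial is the multiset of
  its monomials, a monomial being repeated according to its coefficient.
\<close>

type_synonym monomial = "(nat \<Rightarrow> label) \<times> (nat \<Rightarrow> label)"

type_synonym polynomial = "monomial multiset"

definition index_tuples :: "nat \<Rightarrow> nat \<Rightarrow> (nat \<Rightarrow> nat) set" where
  "index_tuples n N = {1..n} \<rightarrow>\<^sub>E {1..N}"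

definition observable ::
  "nat \<Rightarrow> nat \<times> nat \<times> nat \<Rightarrow> (nat \<Rightarrow> nat) \<Rightarrow> (nat \<Rightarrow> nat) \<Rightarrow> (nat \<Rightarrow> nat) \<Rightarrow> polynomial" where
  "observable n = (\<lambda>(N1, N2, N3) \<sigma>1 \<sigma>2 \<sigma>3.
     image_mset
       (\<lambda>(i1, i2, i3). (\<lambda>m. (i1 m, i2 m, i3 m), \<lambda>m. (i1 (\<sigma>1 m), i2 (\<sigma>2 m), i3 (\<sigma>3 m))))
       (mset_set (index_tuples n N1 \<times> index_tuples n N2 \<times> index_tuples n N3)))"

definition conj_observable ::
  "nat \<Rightarrow> nat \<times> nat \<times> nat \<Rightarrow> (nat \<Rightarrow> nat) \<Rightarrow> (nat \<Rightarrow> nat) \<Rightarrow> (nat \<Rightarrow> nat) \<Rightarrow> polynomial" where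
  "conj_observable n N \<tau>1 \<tau>2 \<tau>3 = observable n N (inv \<tau>1) (inv \<tau>2) (inv \<tau>3)"

definition eval_polynomial :: "nat \<Rightarrow> (label \<Rightarrow> complex) \<Rightarrow> polynomial \<Rightarrow> complex" where
  "eval_polynomial n \<Phi> P =
     (\<Sum>(u, v)\<in>#P. (\<Prod>m=1..n. \<Phi> (u m)) * (\<Prod>m=1..n. cnj (\<Phi> (v m))))"

lemma eval_observable:
  "eval_polynomial n \<Phi> (observable n (N1, N2, N3) \<sigma>1 \<sigma>2 \<sigma>3) =
     (\<Sum>i1\<in>index_tuples n N1. \<Sum>i2\<in>index_tuples n N2. \<Sum>i3\<in>index_tuples n N3.
        (\<Prod>m=1..n. \<Phi> (i1 m, i2 m, i3 m)) *
        (\<Prod>m=1..n. cnj (\<Phi> (i1 (\<sigma>1 m), i2 (\<sigma>2 m), i3 (\<sigma>3 m)))))"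
  by (simp add: eval_polynomial_def observable_def image_mset.compositionality comp_def
      case_prod_unfold sum_unfold_sum_mset[symmetric] sum.cartesian_product)

definition propagator :: "label \<Rightarrow> label \<Rightarrow> real" where
  "propagator = (\<lambda>(i1, i2, i3) (j1, j2, j3).
     of_bool (i1 = j1) * of_bool (i2 = j2) * of_bool (i3 = j3))"

text \<open>
  In a product of two monomials, the factor number m of the monomial number b
  sits at position (b, m), both for \<open>\<Phi>\<close> and for \<open>\<Phi>\<close>-bar. The matching \<open>\<pi>\<close> pairs the
  \<open>\<Phi>\<close> at position x with the \<open>\<Phi>\<close>-bar at position \<open>\<pi> x\<close>.
\<close>

definition positions :: "nat \<Rightarrow> (nat \<times> nat) set" where
  "positions n = {1, 2} \<times> {1..n}"

definition wick_contractions :: "nat \<Rightarrow> (nat \<times> nat \<Rightarrow> nat \<times> nat) set" where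
  "wick_contractions n = {\<pi>. \<pi> permutes positions n}"

definition normal_ordered_contractions :: "nat \<Rightarrow> (nat \<times> nat \<Rightarrow> nat \<times> nat) set" where
  "normal_ordered_contractions n =
     {\<pi> \<in> wick_contractions n. \<forall>x\<in>positions n. fst (\<pi> x) \<noteq> fst x}"

definition monomial_two_point :: "nat \<Rightarrow> monomial \<Rightarrow> monomial \<Rightarrow> real" where
  "monomial_two_point n = (\<lambda>(u, v) (u', v').
     \<Sum>\<pi>\<in>normal_ordered_contractions n. \<Prod>x\<in>positions n.
       propagator
         (case x of (b, m) \<Rightarrow> if b = 1 then u m else u' m)
         (case \<pi> x of (b, m) \<Rightarrow> if b = 1 then v m else v' m))"

definition two_point :: "nat \<Rightarrow> polynomial \<Rightarrow> polynomial \<Rightarrow> real" where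
  "two_point n P Q = (\<Sum>p\<in>#P. \<Sum>q\<in>#Q. monomial_two_point n p q)"

end

theory Submission
  imports Defs
begin

text \<open>
  A normal-ordered contraction amounts to two permutations \<open>\<alpha>, \<beta>\<close> of \<open>{1..n}\<close>: \<open>\<alpha>\<close> matches the
  \<open>\<Phi>\<close>s of the first observable with the \<open>\<Phi>\<close>-bars of the second, and \<open>\<beta>\<close> those of the second
  with those of the first. Summing over the indices of colour a imposes
  \<open>i = i \<circ> \<sigma>\<^sub>a \<circ> \<beta> \<circ> \<tau>\<^sub>a\<inverse> \<circ> \<alpha>\<close> on the index tuples of the first observable. After division by
  \<open>N\<^sub>a ^ n\<close> the number of solutions is 1 if that permutation is the identity, that is
  \<open>\<tau>\<^sub>a = \<alpha> \<circ> \<sigma>\<^sub>a \<circ> \<beta>\<close>, and at most \<open>1 / N\<^sub>a\<close> otherwise. So the limit counts the pairs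
  \<open>(\<alpha>, \<beta>)\<close> that carry \<open>\<sigma>\<close> to \<open>\<tau>\<close>.
\<close>

section \<open>Normal-ordered contractions as pairs of permutations\<close>

text \<open>Leaving every pair outside \<open>positions n\<close> fixed is what
  \<open>permutes\<close> demands.\<close>

definition swap_matching ::
  "nat \<Rightarrow> (nat \<Rightarrow> nat) \<Rightarrow> (nat \<Rightarrow> nat) \<Rightarrow> nat \<times> nat \<Rightarrow> nat \<times> nat" where
  "swap_matching n \<alpha> \<beta> = (\<lambda>(b, m).
     if m \<in> {1..n} \<and> b = 1 then (2, \<alpha> m)
     else if m \<in> {1..n} \<and> b = 2 then (1, \<beta> m)
     else (b, m))"

lemma swap_matching_simps:
  assumes "m \<in> {1..n}"
  shows "swap_matching n \<alpha> \<beta> (1, m) = (2, \<alpha> m)" "swap_matching n \<alpha> \<beta> (2, m) = (1, \<beta> m)"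
    "swap_matching n \<alpha> \<beta> (Suc 0, m) = (2, \<alpha> m)"
  using assms by (auto simp: swap_matching_def)

lemma swap_matching_normal_ordered:
  assumes "\<alpha> permutes {1..n}" "\<beta> permutes {1..n}"
  shows "swap_matching n \<alpha> \<beta> \<in> normal_ordered_contractions n"
proof -
  have mem: "\<alpha> m \<in> {1..n}" "\<beta> m \<in> {1..n}" if "m \<in> {1..n}" for m
    using that by (simp_all only: permutes_in_image[OF assms(1)] permutes_in_image[OF assms(2)])
  have "bij_betw (swap_matching n \<alpha> \<beta>) (positions n) (positions n)"
  \<comment> \<open>The way back from block 2 undoes \<open>\<alpha>\<close>, and the way back from
    block 1 undoes \<open>\<beta>\<close>, so the inverse matching has the inverses in exchanged
    order.\<close>
  proof (rule bij_betw_byWitness[where f' = "swap_matching n (inv \<beta>) (inv \<alpha>)"])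
    have inv: "inv \<alpha> m \<in> {1..n}" "inv \<beta> m \<in> {1..n}" if "m \<in> {1..n}" for m
      using that by (simp_all only: permutes_in_image[OF permutes_inv[OF assms(1)]]
          permutes_in_image[OF permutes_inv[OF assms(2)]])
    show "\<forall>x\<in>positions n. swap_matching n (inv \<beta>) (inv \<alpha>) (swap_matching n \<alpha> \<beta> x) = x"
      using mem permutes_inverses[OF assms(1)] permutes_inverses[OF assms(2)]
      by (auto simp: positions_def swap_matching_simps simp del: atLeastAtMost_iff One_nat_def)
    show "\<forall>x\<in>positions n. swap_matching n \<alpha> \<beta> (swap_matching n (inv \<beta>) (inv \<alpha>) x) = x"
      using inv permutes_inverses[OF assms(1)] permutes_inverses[OF assms(2)]
      by (auto simp: positions_def swap_matching_simps simp del: atLeastAtMost_iff One_nat_def)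
    show "swap_matching n \<alpha> \<beta> ` positions n \<subseteq> positions n"
      using mem by (auto simp: positions_def swap_matching_simps simp del: atLeastAtMost_iff One_nat_def)
    show "swap_matching n (inv \<beta>) (inv \<alpha>) ` positions n \<subseteq> positions n"
      using inv by (auto simp: positions_def swap_matching_simps simp del: atLeastAtMost_iff One_nat_def)
  qed
  moreover have "swap_matching n \<alpha> \<beta> x = x" if "x \<notin> positions n" for x
    using that by (auto simp: positions_def swap_matching_def split: prod.splits)
  ultimately have "swap_matching n \<alpha> \<beta> permutes positions n"
    by (rule bij_imp_permutes)
  moreover have "fst (swap_matching n \<alpha> \<beta> x) \<noteq> fst x" if "x \<in> positions n" for x
    using that by (auto simp: positions_def swap_matching_def)
  ultimately show ?thesis
    by (simp add: normal_ordered_contractions_def wick_contractions_def)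
qed

lemma permutes_if_inj_maps:
  assumes "finite A" "inj_on f A" "f ` A \<subseteq> A"
  shows "(\<lambda>x. if x \<in> A then f x else x) permutes A"
proof (rule bij_imp_permutes)
  have "bij_betw f A A"
    using assms by (simp add: bij_betw_def endo_inj_surj)
  then show "bij_betw (\<lambda>x. if x \<in> A then f x else x) A A"
    by (simp cong: bij_betw_cong)
qed simp

text \<open>With only two observables, avoiding one's own block forces the other one, so
  \<open>\<pi>\<close> exchanges the blocks. Its second component on each block is then injective
  because \<open>\<pi>\<close> is, and finiteness makes it a permutation once it is extended by the
  identity.\<close>

lemma normal_ordered_eq_swap_matching:
  assumes "\<pi> \<in> normal_ordered_contractions n"
  shows "\<exists>\<alpha> \<beta>. \<alpha> permutes {1..n} \<and> \<beta> permutes {1..n} \<and> \<pi> = swap_matching n \<alpha> \<beta>"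
proof -
  have perm: "\<pi> permutes positions n" and no: "\<And>x. x \<in> positions n \<Longrightarrow> fst (\<pi> x) \<noteq> fst x"
    using assms by (auto simp: normal_ordered_contractions_def wick_contractions_def)
  define f where "f b m = snd (\<pi> (b, m))" for b m
  have mem: "\<pi> x \<in> positions n" if "x \<in> positions n" for x
    using perm that by (simp add: permutes_in_image)
  have f: "f b m \<in> {1..n}" if "b \<in> {1, 2}" "m \<in> {1..n}" for b m
    using mem[of "(b, m)"] that unfolding f_def positions_def by auto
  have eq: "\<pi> (1, m) = (2, f 1 m)" "\<pi> (2, m) = (1, f 2 m)" if "m \<in> {1..n}" for m
    using mem[of "(1, m)"] mem[of "(2, m)"] no[of "(1, m)"] no[of "(2, m)"] that
    unfolding f_def positions_def by (cases "\<pi> (1, m)"; cases "\<pi> (2, m)"; auto)+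
  have "inj \<pi>" using perm by (rule permutes_inj)
  then have inj: "inj_on (f 1) {1..n}" "inj_on (f 2) {1..n}"
    using eq by (metis (mono_tags, lifting) inj_onI injD prod.inject)+
  define \<alpha> where "\<alpha> m = (if m \<in> {1..n} then f 1 m else m)" for m
  define \<beta> where "\<beta> m = (if m \<in> {1..n} then f 2 m else m)" for m
  have "\<alpha> permutes {1..n}" "\<beta> permutes {1..n}"
    unfolding \<alpha>_def[abs_def] \<beta>_def[abs_def]
    using f inj by (intro permutes_if_inj_maps; auto)+
  moreover have "\<pi> x = swap_matching n \<alpha> \<beta> x" for x
  proof (cases "x \<in> positions n")
    case True
    then show ?thesis
      using eq by (auto simp: positions_def swap_matching_def \<alpha>_def \<beta>_def)
  next
    case False
    then have "\<pi> x = x" using perm by (simp add: permutes_not_in)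
    then show ?thesis using False
      by (auto simp: positions_def swap_matching_def split: prod.splits)
  qed
  ultimately show ?thesis by blast
qed

lemma bij_betw_swap_matching:
  "bij_betw (\<lambda>(\<alpha>, \<beta>). swap_matching n \<alpha> \<beta>)
     ({\<alpha>. \<alpha> permutes {1..n}} \<times> {\<beta>. \<beta> permutes {1..n}}) (normal_ordered_contractions n)"
proof (rule bij_betw_imageI)
  show "inj_on (\<lambda>(\<alpha>, \<beta>). swap_matching n \<alpha> \<beta>)
     ({\<alpha>. \<alpha> permutes {1..n}} \<times> {\<beta>. \<beta> permutes {1..n}})"
  proof (rule inj_onI, clarify, intro conjI ext)
    fix \<alpha> \<beta> \<alpha>' \<beta>' m
    assume perm: "\<alpha> permutes {1..n}" "\<beta> permutes {1..n}" "\<alpha>' permutes {1..n}" "\<beta>' permutes {1..n}"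
      and eq: "swap_matching n \<alpha> \<beta> = swap_matching n \<alpha>' \<beta>'"
    \<comment> \<open>Matchings see the permutations only on \<open>{1..n}\<close>; elsewhere all of
      them are the identity.\<close>
    show "\<alpha> m = \<alpha>' m"
      using perm fun_cong[OF eq, of "(1, m)"]
      by (cases "m \<in> {1..n}") (simp_all add: swap_matching_def permutes_not_in)
    show "\<beta> m = \<beta>' m"
      using perm fun_cong[OF eq, of "(2, m)"]
      by (cases "m \<in> {1..n}") (simp_all add: swap_matching_def permutes_not_in)
  qed
next
  show "(\<lambda>(\<alpha>, \<beta>). swap_matching n \<alpha> \<beta>) `
     ({\<alpha>. \<alpha> permutes {1..n}} \<times> {\<beta>. \<beta> permutes {1..n}}) = normal_ordered_contractions n"
  proof (intro equalityI subsetI)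
    fix \<pi> assume "\<pi> \<in> normal_ordered_contractions n"
    then obtain \<alpha> \<beta> where "\<alpha> permutes {1..n}" "\<beta> permutes {1..n}" "\<pi> = swap_matching n \<alpha> \<beta>"
      using normal_ordered_eq_swap_matching by blast
    then show "\<pi> \<in> (\<lambda>(\<alpha>, \<beta>). swap_matching n \<alpha> \<beta>) `
        ({\<alpha>. \<alpha> permutes {1..n}} \<times> {\<beta>. \<beta> permutes {1..n}})"
      by (intro image_eqI[of _ _ "(\<alpha>, \<beta>)"]) simp_all
  qed (auto intro: swap_matching_normal_ordered)
qed

section \<open>Summation over the indices for a fixed contraction\<close>

lemma finite_index_tuples [simp]: "finite (index_tuples n N)"
  by (simp add: index_tuples_def finite_PiE)

lemma card_index_tuples: "card (index_tuples n N) = N ^ n"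
  by (simp add: index_tuples_def card_PiE)

text \<open>For a permutation \<open>\<rho>\<close> of \<open>{1..n}\<close> these are the tuples
  constant on its cycles.\<close>

definition invariant_tuples :: "nat \<Rightarrow> nat \<Rightarrow> (nat \<Rightarrow> nat) \<Rightarrow> (nat \<Rightarrow> nat) set" where
  "invariant_tuples n N \<rho> = {i \<in> index_tuples n N. \<forall>m\<in>{1..n}. i (\<rho> m) = i m}"

text \<open>The second family of equations determines \<open>j\<close> from \<open>i\<close>, so the
  inner sum has at most one nonzero term. Substituting that \<open>j\<close> into the first family
  leaves the invariance of \<open>i\<close>.\<close>

lemma sum_colour_constraints:
  assumes "\<sigma> permutes {1..n}" "\<tau> permutes {1..n}" "\<alpha> permutes {1..n}" "\<beta> permutes {1..n}"
  shows "(\<Sum>i\<in>index_tuples n N. \<Sum>j\<in>index_tuples n N.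
            of_bool (\<forall>m\<in>{1..n}. i m = j (inv \<tau> (\<alpha> m)) \<and> j m = i (\<sigma> (\<beta> m)))) =
         real (card (invariant_tuples n N (\<sigma> \<circ> \<beta> \<circ> inv \<tau> \<circ> \<alpha>)))"
proof -
  let ?I = "index_tuples n N" and ?F = "invariant_tuples n N (\<sigma> \<circ> \<beta> \<circ> inv \<tau> \<circ> \<alpha>)"
  \<comment> \<open>The restriction makes \<open>g i\<close> extensional, so that agreement with
    \<open>j\<close> on \<open>{1..n}\<close> becomes equality of functions.\<close>
  define g where "g i = restrict (i \<circ> \<sigma> \<circ> \<beta>) {1..n}" for i :: "nat \<Rightarrow> nat"
  have in1: "inv \<tau> (\<alpha> m) \<in> {1..n}" "\<sigma> (\<beta> m) \<in> {1..n}" if "m \<in> {1..n}" for m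
    using assms that permutes_in_image permutes_inv by metis+
  have g: "g i \<in> ?I" if "i \<in> ?I" for i
    using that in1 by (auto simp: g_def index_tuples_def simp del: atLeastAtMost_iff)
  have iff: "(\<forall>m\<in>{1..n}. i m = j (inv \<tau> (\<alpha> m)) \<and> j m = i (\<sigma> (\<beta> m))) \<longleftrightarrow> j = g i \<and> i \<in> ?F"
    if "i \<in> ?I" "j \<in> ?I" for i j
  proof -
    have "(\<forall>m\<in>{1..n}. j m = i (\<sigma> (\<beta> m))) \<longleftrightarrow> j = g i"
      using that(2) by (auto simp: g_def index_tuples_def fun_eq_iff PiE_def extensional_def)
    \<comment> \<open>Since \<open>inv \<tau> (\<alpha> m)\<close> stays in \<open>{1..n}\<close>,
      the restricted tuple is never evaluated where it is \<open>undefined\<close>.\<close>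
    moreover have "(\<forall>m\<in>{1..n}. i m = j (inv \<tau> (\<alpha> m))) \<longleftrightarrow> i \<in> ?F" if "j = g i"
      using that \<open>i \<in> ?I\<close> in1(1)
      by (auto simp: g_def invariant_tuples_def simp del: atLeastAtMost_iff)
    ultimately show ?thesis by blast
  qed
  have "(\<Sum>i\<in>?I. \<Sum>j\<in>?I.
            of_bool (\<forall>m\<in>{1..n}. i m = j (inv \<tau> (\<alpha> m)) \<and> j m = i (\<sigma> (\<beta> m)))) =
        (\<Sum>i\<in>?I. \<Sum>j\<in>?I. if j = g i then of_bool (i \<in> ?F) else (0::real))"
    by (intro sum.cong refl) (subst iff; simp)
  also have "\<dots> = (\<Sum>i\<in>?I. of_bool (i \<in> ?F))"
    using g by (intro sum.cong refl) simp
  also have "\<dots> = real (card ?F)"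
    by (simp add: sum.If_cases of_bool_def invariant_tuples_def Int_def conj_ac)
  finally show ?thesis .
qed

lemma prod_of_bool:
  "finite A \<Longrightarrow> (\<Prod>x\<in>A. of_bool (P x)) = (of_bool (\<forall>x\<in>A. P x) :: 'a::comm_semiring_1)"
  by (induction rule: finite_induct) auto

text \<open>Each propagator is a product of three Kronecker deltas, one per colour, so the colours
  decouple. The \<open>\<Phi>\<close>s of the first observable yield the equations for the
  \<open>i\<close>s, those of the second the equations for the \<open>j\<close>s.\<close>

lemma prod_propagators_swap_matching:
  assumes "\<alpha> permutes {1..n}" "\<beta> permutes {1..n}"
  shows "(\<Prod>x\<in>positions n. propagator
         (case x of (b, m) \<Rightarrow> if b = 1 then (i1 m, i2 m, i3 m) else (j1 m, j2 m, j3 m))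
         (case swap_matching n \<alpha> \<beta> x of (b, m) \<Rightarrow>
            if b = 1 then (i1 (\<sigma>1 m), i2 (\<sigma>2 m), i3 (\<sigma>3 m)) else (j1 (t1 m), j2 (t2 m), j3 (t3 m)))) =
       of_bool (\<forall>m\<in>{1..n}. i1 m = j1 (t1 (\<alpha> m)) \<and> j1 m = i1 (\<sigma>1 (\<beta> m))) *
       of_bool (\<forall>m\<in>{1..n}. i2 m = j2 (t2 (\<alpha> m)) \<and> j2 m = i2 (\<sigma>2 (\<beta> m))) *
       of_bool (\<forall>m\<in>{1..n}. i3 m = j3 (t3 (\<alpha> m)) \<and> j3 m = i3 (\<sigma>3 (\<beta> m)))"
    (is "(\<Prod>x\<in>_. ?f x) = _")
proof -
  have "prod ?f (positions n) = (\<Prod>m\<in>{1..n}. ?f (1, m)) * (\<Prod>m\<in>{1..n}. ?f (2, m))"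
    by (simp add: positions_def prod.cartesian_product')
  also have "(\<Prod>m\<in>{1..n}. ?f (1, m)) = (\<Prod>m\<in>{1..n}. of_bool
      (i1 m = j1 (t1 (\<alpha> m)) \<and> i2 m = j2 (t2 (\<alpha> m)) \<and> i3 m = j3 (t3 (\<alpha> m))))"
    by (intro prod.cong refl) (simp add: swap_matching_simps propagator_def del: atLeastAtMost_iff)
  also have "(\<Prod>m\<in>{1..n}. ?f (2, m)) = (\<Prod>m\<in>{1..n}. of_bool
      (j1 m = i1 (\<sigma>1 (\<beta> m)) \<and> j2 m = i2 (\<sigma>2 (\<beta> m)) \<and> j3 m = i3 (\<sigma>3 (\<beta> m))))"
    by (intro prod.cong refl) (simp add: swap_matching_simps propagator_def del: atLeastAtMost_iff)
  finally show ?thesis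
    by (simp only: prod_of_bool finite_atLeastAtMost of_bool_conj[symmetric])
      (rule arg_cong[where f = of_bool], blast)
qed

text \<open>An exact formula at finite sizes: for a fixed contraction, the sum over the indices
  splits into one count per colour.\<close>

lemma two_point_eq_sum_card:
  assumes "\<sigma>1 permutes {1..n}" "\<sigma>2 permutes {1..n}" "\<sigma>3 permutes {1..n}"
    and "\<tau>1 permutes {1..n}" "\<tau>2 permutes {1..n}" "\<tau>3 permutes {1..n}"
  shows "two_point n (observable n (N1, N2, N3) \<sigma>1 \<sigma>2 \<sigma>3) (conj_observable n (N1, N2, N3) \<tau>1 \<tau>2 \<tau>3) =
    (\<Sum>(\<alpha>, \<beta>)\<in>{\<alpha>. \<alpha> permutes {1..n}} \<times> {\<beta>. \<beta> permutes {1..n}}.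
       real (card (invariant_tuples n N1 (\<sigma>1 \<circ> \<beta> \<circ> inv \<tau>1 \<circ> \<alpha>))) *
       real (card (invariant_tuples n N2 (\<sigma>2 \<circ> \<beta> \<circ> inv \<tau>2 \<circ> \<alpha>))) *
       real (card (invariant_tuples n N3 (\<sigma>3 \<circ> \<beta> \<circ> inv \<tau>3 \<circ> \<alpha>))))"
    (is "?lhs = (\<Sum>(\<alpha>, \<beta>)\<in>?S. ?C \<alpha> \<beta>)")
proof -
  let ?I1 = "index_tuples n N1" and ?I2 = "index_tuples n N2" and ?I3 = "index_tuples n N3"
  define W where "W \<sigma> \<tau> \<alpha> \<beta> i j =
    (of_bool (\<forall>m\<in>{1..n}. i m = j (inv \<tau> (\<alpha> m)) \<and> j m = i (\<sigma> (\<beta> m))) :: real)"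
    for \<sigma> \<tau> \<alpha> \<beta> :: "nat \<Rightarrow> nat" and i j :: "nat \<Rightarrow> nat"
  have mono: "monomial_two_point n
        (\<lambda>m. (i1 m, i2 m, i3 m), \<lambda>m. (i1 (\<sigma>1 m), i2 (\<sigma>2 m), i3 (\<sigma>3 m)))
        (\<lambda>m. (j1 m, j2 m, j3 m), \<lambda>m. (j1 (inv \<tau>1 m), j2 (inv \<tau>2 m), j3 (inv \<tau>3 m))) =
      (\<Sum>(\<alpha>, \<beta>)\<in>?S. W \<sigma>1 \<tau>1 \<alpha> \<beta> i1 j1 * W \<sigma>2 \<tau>2 \<alpha> \<beta> i2 j2 * W \<sigma>3 \<tau>3 \<alpha> \<beta> i3 j3)"
    for i1 i2 i3 j1 j2 j3
    unfolding monomial_two_point_def prod.case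
    by (subst sum.reindex_bij_betw[OF bij_betw_swap_matching, symmetric])
      (auto simp only: W_def prod_propagators_swap_matching split: prod.splits intro!: sum.cong)
  have "?lhs = (\<Sum>i1\<in>?I1. \<Sum>i2\<in>?I2. \<Sum>i3\<in>?I3. \<Sum>j1\<in>?I1. \<Sum>j2\<in>?I2. \<Sum>j3\<in>?I3. \<Sum>(\<alpha>, \<beta>)\<in>?S.
      W \<sigma>1 \<tau>1 \<alpha> \<beta> i1 j1 * W \<sigma>2 \<tau>2 \<alpha> \<beta> i2 j2 * W \<sigma>3 \<tau>3 \<alpha> \<beta> i3 j3)"
    unfolding two_point_def conj_observable_def observable_def
    by (simp add: image_mset.compositionality comp_def case_prod_unfold mono[unfolded case_prod_unfold]
      sum_unfold_sum_mset[symmetric] sum.cartesian_product')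
  \<comment> \<open>The set of contractions does not depend on the indices, so its sum can be moved
    outermost.\<close>
  also have "\<dots> = (\<Sum>(\<alpha>, \<beta>)\<in>?S.
      \<Sum>i1\<in>?I1. \<Sum>i2\<in>?I2. \<Sum>i3\<in>?I3. \<Sum>j1\<in>?I1. \<Sum>j2\<in>?I2. \<Sum>j3\<in>?I3.
      W \<sigma>1 \<tau>1 \<alpha> \<beta> i1 j1 * W \<sigma>2 \<tau>2 \<alpha> \<beta> i2 j2 * W \<sigma>3 \<tau>3 \<alpha> \<beta> i3 j3)"
    by (simp only: case_prod_unfold sum.swap[of _ ?S])
  \<comment> \<open>Each factor \<open>W\<close> involves the indices of one colour only, so the
    sixfold sum becomes a product of three double sums.\<close>
  also have "\<dots> = (\<Sum>(\<alpha>, \<beta>)\<in>?S. (\<Sum>i1\<in>?I1. \<Sum>j1\<in>?I1. W \<sigma>1 \<tau>1 \<alpha> \<beta> i1 j1) *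
      (\<Sum>i2\<in>?I2. \<Sum>j2\<in>?I2. W \<sigma>2 \<tau>2 \<alpha> \<beta> i2 j2) * (\<Sum>i3\<in>?I3. \<Sum>j3\<in>?I3. W \<sigma>3 \<tau>3 \<alpha> \<beta> i3 j3))"
    by (simp only: sum_distrib_left[symmetric] sum_distrib_right[symmetric])
  also have "\<dots> = (\<Sum>(\<alpha>, \<beta>)\<in>?S. ?C \<alpha> \<beta>)"
    unfolding W_def using assms
    by (intro sum.cong refl) (clarsimp simp only: sum_colour_constraints mem_Sigma_iff mem_Collect_eq split: prod.splits)
  finally show ?thesis .
qed

section \<open>Asymptotics of the number of invariant tuples\<close>

text \<open>The entry at a moved point \<open>m\<close> repeats the entry at
  \<open>\<rho> m\<close>, so deleting it loses no information, and only \<open>n - 1\<close>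
  entries remain free.\<close>

lemma card_invariant_tuples_le:
  assumes "m \<in> {1..n}" "\<rho> m \<in> {1..n}" "\<rho> m \<noteq> m"
  shows "card (invariant_tuples n N \<rho>) \<le> N ^ (n - 1)"
proof -
  let ?A = "{1..n} - {m}"
  have "inj_on (\<lambda>i. restrict i ?A) (invariant_tuples n N \<rho>)"
  proof (rule inj_onI)
    fix i j
    assume i: "i \<in> invariant_tuples n N \<rho>" and j: "j \<in> invariant_tuples n N \<rho>"
      and eq: "restrict i ?A = restrict j ?A"
    have A: "i k = j k" if "k \<in> ?A" for k
      using that fun_cong[OF eq, of k] by simp
    have "i m = i (\<rho> m)" "j m = j (\<rho> m)"
      using i j assms(1) by (simp_all add: invariant_tuples_def)
    then have "i m = j m" using A assms by simp
    then have "i k = j k" if "k \<in> {1..n}" for k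
      using A that by (cases "k = m") auto
    then show "i = j"
      using i j by (intro PiE_ext[of _ "{1..n}" "\<lambda>_. {1..N}"])
        (auto simp: invariant_tuples_def index_tuples_def)
  qed
  moreover have "(\<lambda>i. restrict i ?A) ` invariant_tuples n N \<rho> \<subseteq> ?A \<rightarrow>\<^sub>E {1..N}"
    by (intro image_subsetI restrict_PiE_iff[THEN iffD2])
      (auto simp: invariant_tuples_def index_tuples_def)
  ultimately have "card (invariant_tuples n N \<rho>) \<le> card (?A \<rightarrow>\<^sub>E {1..N})"
    by (intro card_inj_on_le) (auto intro: finite_PiE)
  also have "\<dots> = N ^ (n - 1)"
    using assms(1) by (simp add: card_PiE)
  finally show ?thesis .
qed

lemma tendsto_card_invariant_tuples:
  assumes "\<rho> permutes {1..n}"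
  shows "((\<lambda>N. real (card (invariant_tuples n N \<rho>)) / real N ^ n) \<longlongrightarrow> of_bool (\<rho> = id)) at_top"
proof (cases "\<rho> = id")
  case True
  then have "card (invariant_tuples n N \<rho>) = N ^ n" for N
    by (simp add: invariant_tuples_def card_index_tuples)
  \<comment> \<open>For \<open>N = 0\<close> and positive \<open>n\<close> the quotient is
    \<open>0 / 0\<close>, which evaluates to 0, so the value 1 is claimed only eventually.\<close>
  then have "eventually (\<lambda>N. real (card (invariant_tuples n N \<rho>)) / real N ^ n = 1) at_top"
    by (intro eventually_mono[OF eventually_gt_at_top[of 0]]) simp
  then show ?thesis using True by (simp add: tendsto_eventually)
next
  case False
  then obtain m where m: "\<rho> m \<noteq> m" by (auto simp: fun_eq_iff)
  then have "m \<in> {1..n}" using assms by (meson permutes_not_in)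
  moreover from this have "\<rho> m \<in> {1..n}" by (simp only: permutes_in_image[OF assms])
  ultimately have le: "card (invariant_tuples n N \<rho>) \<le> N ^ (n - 1)" for N
    using m by (intro card_invariant_tuples_le)
  have "((\<lambda>N. real (card (invariant_tuples n N \<rho>)) / real N ^ n) \<longlongrightarrow> 0) at_top"
  proof (rule tendsto_sandwich[OF _ _ tendsto_const lim_inverse_n])
    show "\<forall>\<^sub>F N in at_top. real (card (invariant_tuples n N \<rho>)) / real N ^ n \<le> inverse (real N)"
      using eventually_gt_at_top[of 0]
    proof eventually_elim
      case (elim N)
      have "real (card (invariant_tuples n N \<rho>)) / real N ^ n \<le> real N ^ (n - 1) / real N ^ n"
        using le[of N] by (intro divide_right_mono) (simp_all flip: of_nat_power)
      also have "\<dots> = inverse (real N)"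
        \<comment> \<open>The moved point \<open>m\<close> rules out \<open>n = 0\<close>, where
          \<open>n - 1\<close> would be truncated.\<close>
        using elim \<open>m \<in> {1..n}\<close> by (cases n) (simp_all add: field_simps)
      finally show ?case .
    qed
  qed simp
  then show ?thesis using False by simp
qed

text \<open>Conjugation by \<open>\<alpha>\<close> brings the last factor to the front: the product
  is the identity exactly when
  \<open>\<alpha> \<circ> \<sigma> \<circ> \<beta> \<circ> inv \<tau>\<close> is.\<close>

lemma comp_inv_comp_eq_id_iff:
  assumes "bij \<sigma>" "bij \<tau>" "bij \<alpha>" "bij \<beta>"
  shows "\<sigma> \<circ> \<beta> \<circ> inv \<tau> \<circ> \<alpha> = id \<longleftrightarrow> \<tau> = \<alpha> \<circ> \<sigma> \<circ> \<beta>"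
proof
  assume id: "\<sigma> \<circ> \<beta> \<circ> inv \<tau> \<circ> \<alpha> = id"
  show "\<tau> = \<alpha> \<circ> \<sigma> \<circ> \<beta>"
  proof
    fix x
    \<comment> \<open>This choice gives \<open>inv \<tau> (\<alpha> y) = x\<close>, so evaluating
      the identity at \<open>y\<close> exposes \<open>\<sigma> (\<beta> x)\<close>.\<close>
    obtain y where y: "\<tau> x = \<alpha> y" using assms(3) by (meson bij_pointE)
    have "\<sigma> (\<beta> x) = y"
      using fun_cong[OF id, of y] y assms(2) by (metis bij_inv_eq_iff comp_apply id_apply)
    then show "\<tau> x = (\<alpha> \<circ> \<sigma> \<circ> \<beta>) x" using y by simp
  qed
next
  assume eq: "\<tau> = \<alpha> \<circ> \<sigma> \<circ> \<beta>"
  show "\<sigma> \<circ> \<beta> \<circ> inv \<tau> \<circ> \<alpha> = id"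
  proof
    fix x
    have "\<alpha> (\<sigma> (\<beta> (inv \<tau> (\<alpha> x)))) = \<alpha> x"
      using fun_cong[OF eq, of "inv \<tau> (\<alpha> x)"] assms(2) by (simp add: bij_is_surj surj_f_inv_f)
    then show "(\<sigma> \<circ> \<beta> \<circ> inv \<tau> \<circ> \<alpha>) x = id x"
      using assms(3) by (simp add: bij_is_inj inj_eq)
  qed
qed

section \<open>The limit of the two-point function and its sign\<close>

lemma tendsto_card_invariant_tuples_comp:
  assumes "\<sigma> permutes {1..n}" "\<tau> permutes {1..n}" "\<alpha> permutes {1..n}" "\<beta> permutes {1..n}"
  shows "((\<lambda>N. real (card (invariant_tuples n N (\<sigma> \<circ> \<beta> \<circ> inv \<tau> \<circ> \<alpha>))) / real N ^ n)
           \<longlongrightarrow> of_bool (\<tau> = \<alpha> \<circ> \<sigma> \<circ> \<beta>)) at_top"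
  using tendsto_card_invariant_tuples[of "\<sigma> \<circ> \<beta> \<circ> inv \<tau> \<circ> \<alpha>" n] assms
  by (simp add: permutes_compose permutes_inv permutes_bij comp_inv_comp_eq_id_iff)

theorem mainTheorem10:
  fixes n :: nat and \<sigma>1 \<sigma>2 \<sigma>3 \<tau>1 \<tau>2 \<tau>3 :: "nat \<Rightarrow> nat"
  assumes "n \<ge> 1"
    and "\<sigma>1 permutes {1..n}" and "\<sigma>2 permutes {1..n}" and "\<sigma>3 permutes {1..n}"
    and "\<tau>1 permutes {1..n}" and "\<tau>2 permutes {1..n}" and "\<tau>3 permutes {1..n}"
  shows "\<exists>L::real.
    ((\<lambda>(N1, N2, N3).
        two_point n (observable n (N1, N2, N3) \<sigma>1 \<sigma>2 \<sigma>3) (conj_observable n (N1, N2, N3) \<tau>1 \<tau>2 \<tau>3)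
          / (real N1 ^ n * real N2 ^ n * real N3 ^ n))
      \<longlongrightarrow> L) (at_top \<times>\<^sub>F at_top \<times>\<^sub>F at_top) \<and>
    (if \<exists>\<gamma>1 \<gamma>2. \<gamma>1 permutes {1..n} \<and> \<gamma>2 permutes {1..n} \<and>
          \<tau>1 = \<gamma>1 \<circ> \<sigma>1 \<circ> \<gamma>2 \<and> \<tau>2 = \<gamma>1 \<circ> \<sigma>2 \<circ> \<gamma>2 \<and> \<tau>3 = \<gamma>1 \<circ> \<sigma>3 \<circ> \<gamma>2
     then L > 0 else L = 0)"
proof -
  let ?S = "{\<alpha>. \<alpha> permutes {1..n}} \<times> {\<beta>. \<beta> permutes {1..n}}"
  define g where "g \<sigma> \<tau> = (\<lambda>(\<alpha>, \<beta>) N.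
      real (card (invariant_tuples n N (\<sigma> \<circ> \<beta> \<circ> inv \<tau> \<circ> \<alpha>))) / real N ^ n)"
    for \<sigma> \<tau> :: "nat \<Rightarrow> nat"
  define l where "l \<sigma> \<tau> = (\<lambda>(\<alpha>, \<beta>). of_bool (\<tau> = \<alpha> \<circ> \<sigma> \<circ> \<beta>) :: real)"
    for \<sigma> \<tau> :: "nat \<Rightarrow> nat"
  \<comment> \<open>Each summand is 0 or 1, and it is 1 when the same pair carries
    \<open>\<sigma>\<close> to \<open>\<tau>\<close> in all three colours.\<close>
  define L where "L = (\<Sum>p\<in>?S. l \<sigma>1 \<tau>1 p * l \<sigma>2 \<tau>2 p * l \<sigma>3 \<tau>3 p)"
  have fin: "finite ?S" by (simp add: finite_permutations)
  have g: "(g \<sigma> \<tau> p \<longlongrightarrow> l \<sigma> \<tau> p) at_top"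
    if "p \<in> ?S" "\<sigma> permutes {1..n}" "\<tau> permutes {1..n}" for \<sigma> \<tau> p
    using that tendsto_card_invariant_tuples_comp[of \<sigma> n \<tau> "fst p" "snd p"]
    by (auto simp: g_def l_def)
  let ?F = "at_top \<times>\<^sub>F at_top \<times>\<^sub>F at_top :: (nat \<times> nat \<times> nat) filter"
  have fst: "filterlim fst F (F \<times>\<^sub>F G)" and snd: "filterlim snd G (F \<times>\<^sub>F G)"
    for F :: "'x filter" and G :: "'y filter"
    by (simp_all add: filterlim_def filtermap_fst_prod_filter filtermap_snd_prod_filter)
  \<comment> \<open>The three sizes grow independently; composing with the projections transfers
    each one-variable limit to the product filter.\<close>
  have proj: "filterlim fst at_top ?F" "filterlim (\<lambda>N. fst (snd N)) at_top ?F"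
    "filterlim (\<lambda>N. snd (snd N)) at_top ?F"
    by (rule fst filterlim_compose[OF fst snd] filterlim_compose[OF snd snd])+
  have "((\<lambda>N. \<Sum>p\<in>?S. g \<sigma>1 \<tau>1 p (fst N) * g \<sigma>2 \<tau>2 p (fst (snd N)) * g \<sigma>3 \<tau>3 p (snd (snd N)))
      \<longlongrightarrow> L) ?F"
    unfolding L_def using assms(2-)
    by (intro tendsto_sum tendsto_mult filterlim_compose[OF g proj(1)]
        filterlim_compose[OF g proj(2)] filterlim_compose[OF g proj(3)])
  \<comment> \<open>The normalisation is distributed over the three counts of each summand; this
    also holds where a size is 0, as division by 0 gives 0 on both sides.\<close>
  also have "(\<lambda>N. \<Sum>p\<in>?S. g \<sigma>1 \<tau>1 p (fst N) * g \<sigma>2 \<tau>2 p (fst (snd N)) * g \<sigma>3 \<tau>3 p (snd (snd N))) =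
    (\<lambda>(N1, N2, N3).
        two_point n (observable n (N1, N2, N3) \<sigma>1 \<sigma>2 \<sigma>3) (conj_observable n (N1, N2, N3) \<tau>1 \<tau>2 \<tau>3)
          / (real N1 ^ n * real N2 ^ n * real N3 ^ n))"
    using assms(2-)
    by (simp add: fun_eq_iff two_point_eq_sum_card g_def case_prod_unfold sum_divide_distrib)
  finally have "((\<lambda>(N1, N2, N3).
        two_point n (observable n (N1, N2, N3) \<sigma>1 \<sigma>2 \<sigma>3) (conj_observable n (N1, N2, N3) \<tau>1 \<tau>2 \<tau>3)
          / (real N1 ^ n * real N2 ^ n * real N3 ^ n)) \<longlongrightarrow> L) ?F" .
  \<comment> \<open>The pair \<open>(\<gamma>1, \<gamma>2)\<close> itself contributes 1, and no
    summand is negative.\<close>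
  moreover have "L > 0" if "\<gamma>1 permutes {1..n}" "\<gamma>2 permutes {1..n}"
    "\<tau>1 = \<gamma>1 \<circ> \<sigma>1 \<circ> \<gamma>2" "\<tau>2 = \<gamma>1 \<circ> \<sigma>2 \<circ> \<gamma>2" "\<tau>3 = \<gamma>1 \<circ> \<sigma>3 \<circ> \<gamma>2" for \<gamma>1 \<gamma>2
    unfolding L_def using that
    by (intro sum_pos2[OF fin, of "(\<gamma>1, \<gamma>2)"]) (simp_all add: l_def case_prod_unfold)
  \<comment> \<open>Every pair fails in at least one colour, so each summand has a vanishing
    factor.\<close>
  moreover have "L = 0" if "\<nexists>\<gamma>1 \<gamma>2. \<gamma>1 permutes {1..n} \<and> \<gamma>2 permutes {1..n} \<and>
          \<tau>1 = \<gamma>1 \<circ> \<sigma>1 \<circ> \<gamma>2 \<and> \<tau>2 = \<gamma>1 \<circ> \<sigma>2 \<circ> \<gamma>2 \<and> \<tau>3 = \<gamma>1 \<circ> \<sigma>3 \<circ> \<gamma>2"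
    unfolding L_def using that
    by (intro sum.neutral) (auto simp: l_def)
  ultimately show ?thesis by (intro exI[of _ L]) auto
qed

end
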